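(* Let $k$ be a field of characteristic $0$, and let $\mathcal{A}^h_{\mathrm{TopRec}}$ be the bigraded algebra generated by the elementary tree $\tau=|\vee|$ and the elementary one-loop graph $\ell=|\overset{\frown}{\vee}|$, with differential $d_h$ (all defined in the context). Then the cohomology of $(\mathcal{A}^h_{\mathrm{TopRec}},d_h)$ in bidegree $(2,1)$ is $(\mathcal{A}^h_{\mathrm{TopRec}})^{2,1}$ modulo the relation $\ell\ast_h\tau=\tau\ast_h\ell$: $$H^{2,1}(\mathcal{A}^h_{\mathrm{TopRec}},k)=(\mathcal{A}^h_{\mathrm{TopRec}})^{2,1}\big/\,k\cdot(\ell\ast_h\tau-\tau\ast_h\ell).$$
   Context: Planar binary trees. $Y^n$ is the set of planar binary rooted trees with $n$ internal (trivalent) vertices ($n$ is called the order); such a tree has $n+1$ leaves, numbered $0,\dots,n$ from left to right. $Y^0=\{|\}$, where $|$ is the tree with a single edge and no vertex. The grafting $t_1\vee t_2$ of $t_1\in Y^p$ and $t_2\in Y^q$ is the tree in $Y^{p+q+1}$ whose left branch at the root is $t_1$ and whose right branch is $t_2$. Every tree of order $n\ge 1$ is uniquely of this form. Graphs with loops. A graph $t^g$ of order $n$ with $g$ loops is obtained from a tree $t\in Y^n$ by joining, for each of $g$ distinct indices $i\in\{0,\dots,n-1\}$, the consecutive leaves $i$ and $i+1$ by an additional edge (a loop). So it is encoded by a pair $(t,S)$ with $t\in Y^n$, $S\subseteq\{0,\dots,n-1\}$, $|S|=g$, where $i\in S$ means that leaves $i$ and $i+1$ are joined. The graph is called irregular if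 some leaf is involved in two loops, i.e. if $i,i+1\in S$ for some $i$; otherwise it is regular. $(Y^n)^g$ denotes the set of all such graphs (regular or irregular) of order $n$ with $g$ loops, and $k[Y^\infty]_h$ is the $k$-vector space with basis $\bigcup_{n,g}(Y^n)^g$. Grafting operations. For $t^{g_1}=(t_1,S_1)\in (Y^p)^{g_1}$ and $t^{g_2}=(t_2,S_2)\in(Y^q)^{g_2}$ put $$t^{g_1}\vee t^{g_2}=\bigl(t_1\vee t_2,\;S_1\cup (S_2+p+1)\bigr),\qquad t^{g_1}\overset{\frown}{\vee} t^{g_2}=\bigl(t_1\vee t_2,\;S_1\cup\{p\}\cup (S_2+p+1)\bigr),$$ extended bilinearly. Every graph of order $\ge1$ is uniquely of exactly one of the forms $a\vee b$ or $a\overset{\frown}{\vee}b$. Put $\tau=|\vee|$ and $\ell=|\overset{\frown}{\vee}|$. Product. $\ast_h$ is the $k$-bilinear (associative) product on $k[Y^\infty]_h$ determined recursively by $x\ast_h |=|\ast_h x=x$ and, for graphs $x=x'\,\square_1\,x''$ and $y=y'\,\square_2\,y''$ with $\square_1,\square_2\in\{\vee,\overset{\frown}{\vee}\}$, $$x\ast_h y=(x\ast_h y')\,\square_2\,y''+x'\,\square_1\,(x''\ast_h y).$$ Regular graphs and topological recursion algebra. $\mathcal{A}^h_{\mathrm{Reg}}$ is the quotient algebra of $(k[Y^\infty]_h,\ast_h)$ obtained by setting all irregular graphs equal to $0$ (their span is a two-sided ideal). $\mathcal{A}^h_{\mathrm{TopRec}}$ is the subalgebra of $\mathcal{A}^h_{\mathrm{Reg}}$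 generated by $\tau$ and $\ell$; in it $\ell\ast_h\ell=0$. It is bigraded: $(\mathcal{A}^h_{\mathrm{TopRec}})^{n,g}$ is the subspace of elements that are combinations of graphs of order $n$ with $g$ loops. Differential. $d_h$ is the linear map given on a graph $t^g=(t,S)$ of order $n$ by $d_h(t^g)=\sum_{i=0}^n(-1)^{i+g_i}\;{}_i{\leftrightarrow}_{i+1}(t^g)$, where $g_i=|\{j\in S:j<i\}|$ is the number of loops before leaf $i$, and ${}_i{\leftrightarrow}_{i+1}(t,S)=(t,S\cup\{i\})$ if $i\le n-1$ and $i\notin S$, and $0$ otherwise. It satisfies $d_h\circ d_h=0$, sends irregular graphs to combinations of irregular graphs, and hence induces a map on $\mathcal{A}^h_{\mathrm{Reg}}$, which is the $d_h$ used here. Cohomology. $Z^{n,g}=\{x\in(\mathcal{A}^h_{\mathrm{TopRec}})^{n,g}: d_h(x)=0\}$, $B^{n,g}=\{x\in(\mathcal{A}^h_{\mathrm{TopRec}})^{n,g}: x=d_h(s)\text{ for some } s\in(\mathcal{A}^h_{\mathrm{TopRec}})^{n,g-1}\}$, and $H^{n,g}(\mathcal{A}^h_{\mathrm{TopRec}},k)=Z^{n,g}/B^{n,g}$. *)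

theory Defs
  imports Complex_Main "HOL-Library.Poly_Mapping"
begin

datatype btree = Bar | Graft btree btree

primrec tree_order :: "btree \<Rightarrow> nat" where
  "tree_order Bar = 0"
| "tree_order (Graft t1 t2) = tree_order t1 + tree_order t2 + 1"

text \<open>A pair \<open>(t, S)\<close> is the tree \<open>t\<close> with the leaves \<open>i\<close> and \<open>i + 1\<close> joined by a loop
  for every \<open>i \<in> S\<close>; regular and irregular graphs are both allowed.\<close>

typedef lgraph = "{(t, S). S \<subseteq> {..<tree_order t}}"
  by (rule exI[of _ "(Bar, {})"]) simp

setup_lifting type_definition_lgraph

lift_definition tree_of :: "lgraph \<Rightarrow> btree" is fst .

lift_definition loops :: "lgraph \<Rightarrow> nat set" is snd .

definition gorder :: "lgraph \<Rightarrow> nat" where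
  "gorder x = tree_order (tree_of x)"

definition irregular :: "lgraph \<Rightarrow> bool" where
  "irregular x \<longleftrightarrow> (\<exists>i. i \<in> loops x \<and> Suc i \<in> loops x)"

lift_definition bar :: lgraph is "(Bar, {})" by simp

text \<open>Both grafting operations at once: the last leaf of \<open>x\<close>, which has number \<open>gorder x\<close>, is
  joined to the first leaf of \<open>y\<close> in \<open>graft True x y\<close> and is not joined in \<open>graft False x y\<close>.\<close>

lift_definition graft :: "bool \<Rightarrow> lgraph \<Rightarrow> lgraph \<Rightarrow> lgraph" is
  "\<lambda>b (t1, S1) (t2, S2). (Graft t1 t2,
     S1 \<union> (if b then {tree_order t1} else {}) \<union> (\<lambda>i. i + tree_order t1 + 1) ` S2)"
  by (auto split: if_splits)

lift_definition add_loop :: "nat \<Rightarrow> lgraph \<Rightarrow> lgraph" is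
  "\<lambda>i (t, S). (t, if i < tree_order t then insert i S else S)"
  by (auto split: if_splits)

lemma lgraph_eqI: "tree_of x = tree_of y \<Longrightarrow> loops x = loops y \<Longrightarrow> x = y"
  by transfer auto

lemma tree_of_bar [simp]: "tree_of bar = Bar"
  by transfer simp

lemma loops_bar [simp]: "loops bar = {}"
  by transfer simp

lemma tree_of_graft [simp]: "tree_of (graft b x y) = Graft (tree_of x) (tree_of y)"
  by transfer auto

lemma loops_subset: "loops x \<subseteq> {..<gorder x}"
  unfolding gorder_def by transfer auto

lemma loops_graft: "loops (graft b x y) =
    loops x \<union> (if b then {gorder x} else {}) \<union> (\<lambda>i. i + gorder x + 1) ` loops y"
  unfolding gorder_def by transfer (auto split: prod.splits)

lemma gorder_bar [simp]: "gorder bar = 0"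
  by (simp add: gorder_def)

lemma gorder_graft [simp]: "gorder (graft b x y) = gorder x + gorder y + 1"
  by (simp add: gorder_def)

lemma loops_add_loop: "i < gorder x \<Longrightarrow> loops (add_loop i x) = insert i (loops x)"
  unfolding gorder_def by transfer (auto split: prod.splits)

lemma graft_neq_bar [simp]: "graft b x y \<noteq> bar" "bar \<noteq> graft b x y"
  by (metis btree.distinct(1) tree_of_bar tree_of_graft)+

lemma graft_inject [simp]:
  "graft b x y = graft b' x' y' \<longleftrightarrow> b = b' \<and> x = x' \<and> y = y'"
proof
  assume eq: "graft b x y = graft b' x' y'"
  from arg_cong[OF eq, of tree_of]
  have t: "tree_of x = tree_of x'" "tree_of y = tree_of y'" by auto
  then have o: "gorder x = gorder x'" by (simp add: gorder_def)
  have mid: "gorder u \<in> loops (graft c u v) \<longleftrightarrow> c" for c u v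
    using loops_subset[of u] by (auto simp: loops_graft)
  have left: "loops u = loops (graft c u v) \<inter> {..<gorder u}" for c u v
    using loops_subset[of u] by (auto simp: loops_graft)
  have right: "loops v = {i. i + gorder u + 1 \<in> loops (graft c u v)}" for c u v
    using loops_subset[of u] by (auto simp: loops_graft)
  have "b = b'" using mid[of x b y] mid[of x' b' y'] eq o by simp
  moreover have "loops x = loops x'" using left[of x b y] left[of x' b' y'] eq o by simp
  moreover have "loops y = loops y'" using right[of y x b] right[of y' x' b'] eq o by simp
  ultimately show "b = b' \<and> x = x' \<and> y = y'" using t by (auto intro: lgraph_eqI)
qed auto

lemma lgraph_exhaust [case_names bar graft]:
  obtains "x = bar" | b x1 x2 where "x = graft b x1 x2"
proof (cases "tree_of x")
  case Bar
  then have "x = bar"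
    using loops_subset[of x] by (intro lgraph_eqI) (auto simp: gorder_def)
  then show thesis by (rule that)
next
  case (Graft t1 t2)
  define p where "p = tree_order t1"
  define x1 where "x1 = Abs_lgraph (t1, loops x \<inter> {..<p})"
  define x2 where "x2 = Abs_lgraph (t2, {i. i + p + 1 \<in> loops x})"
  have ls: "loops x \<subseteq> {..<p + tree_order t2 + 1}"
    using loops_subset[of x] Graft by (simp add: gorder_def p_def)
  have 1: "tree_of x1 = t1" "loops x1 = loops x \<inter> {..<p}"
    by (simp_all add: x1_def tree_of.rep_eq loops.rep_eq Abs_lgraph_inverse p_def)
  have "{i. i + p + 1 \<in> loops x} \<subseteq> {..<tree_order t2}" using ls by auto
  then have 2: "tree_of x2 = t2" "loops x2 = {i. i + p + 1 \<in> loops x}"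
    by (simp_all add: x2_def tree_of.rep_eq loops.rep_eq Abs_lgraph_inverse)
  have o: "gorder x1 = p" by (simp add: gorder_def 1 p_def)
  have "j \<in> loops x \<longleftrightarrow> j \<in> loops (graft (p \<in> loops x) x1 x2)" for j
    unfolding loops_graft o 1 2
  proof (cases "j \<le> p")
    case True
    then show "j \<in> loops x \<longleftrightarrow> j \<in> (loops x \<inter> {..<p}) \<union> (if p \<in> loops x then {p} else {}) \<union>
        (\<lambda>i. i + p + 1) ` {i. i + p + 1 \<in> loops x}"
      by (cases "j = p") (auto split: if_splits)
  next
    case False
    have "i + p + 1 \<in> (\<lambda>i. i + p + 1) ` A \<longleftrightarrow> i \<in> A" for i and A :: "nat set"
      by (rule inj_image_mem_iff) (simp add: inj_def)
    moreover from False obtain i where "j = i + p + 1"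
      using less_imp_Suc_add[of p j] by auto
    ultimately show "j \<in> loops x \<longleftrightarrow> j \<in> (loops x \<inter> {..<p}) \<union> (if p \<in> loops x then {p} else {}) \<union>
        (\<lambda>i. i + p + 1) ` {i. i + p + 1 \<in> loops x}"
      by (simp split: if_splits)
  qed
  then have "loops x = loops (graft (p \<in> loops x) x1 x2)"
    by (rule set_eqI)
  moreover have "tree_of x = tree_of (graft (p \<in> loops x) x1 x2)"
    by (simp add: 1 2 Graft)
  ultimately have "x = graft (p \<in> loops x) x1 x2"
    by (rule lgraph_eqI[rotated])
  then show thesis by (rule that)
qed

text \<open>Finitely supported functions \<open>lgraph \<Rightarrow>\<^sub>0 'k\<close> form the vector space with basis \<open>lgraph\<close>.
  (The type class multiplication of \<open>\<Rightarrow>\<^sub>0\<close> is a convolution and is not used.)\<close>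

type_synonym 'k hspace = "lgraph \<Rightarrow>\<^sub>0 'k"

definition hscale :: "'k::field \<Rightarrow> 'k hspace \<Rightarrow> 'k hspace" where
  "hscale c = Poly_Mapping.map ((*) c)"

lemma lookup_hscale [simp]: "Poly_Mapping.lookup (hscale c u) x = c * Poly_Mapping.lookup u x"
  by (simp add: hscale_def Poly_Mapping.map.rep_eq when_def)

interpretation hspace: vector_space hscale
  by standard (auto intro!: poly_mapping_eqI simp: lookup_add algebra_simps)

abbreviation basis :: "lgraph \<Rightarrow> 'k::field hspace" where
  "basis x \<equiv> Poly_Mapping.single x 1"

definition lin_ext :: "(lgraph \<Rightarrow> 'k hspace) \<Rightarrow> 'k::field hspace \<Rightarrow> 'k hspace" where
  "lin_ext f u = (\<Sum>x\<in>Poly_Mapping.keys u. hscale (Poly_Mapping.lookup u x) (f x))"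

definition bilin_ext ::
    "(lgraph \<Rightarrow> lgraph \<Rightarrow> 'k hspace) \<Rightarrow> 'k::field hspace \<Rightarrow> 'k hspace \<Rightarrow> 'k hspace" where
  "bilin_ext f u v = lin_ext (\<lambda>x. lin_ext (f x) v) u"

definition hgraft :: "bool \<Rightarrow> 'k::field hspace \<Rightarrow> 'k hspace \<Rightarrow> 'k hspace" where
  "hgraft b = bilin_ext (\<lambda>x y. basis (graft b x y))"

function gmult :: "lgraph \<Rightarrow> lgraph \<Rightarrow> 'k::field hspace" where
  "gmult bar y = basis y"
| "gmult (graft b x1 x2) bar = basis (graft b x1 x2)"
| "gmult (graft b x1 x2) (graft c y1 y2) =
     hgraft c (gmult (graft b x1 x2) y1) (basis y2) + hgraft b (basis x1) (gmult x2 (graft c y1 y2))"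
proof -
  fix P :: bool and z :: "lgraph \<times> lgraph"
  assume h: "\<And>y. z = (bar, y) \<Longrightarrow> P" "\<And>b x1 x2. z = (graft b x1 x2, bar) \<Longrightarrow> P"
    "\<And>b x1 x2 c y1 y2. z = (graft b x1 x2, graft c y1 y2) \<Longrightarrow> P"
  obtain x y where "z = (x, y)" by (cases z)
  with h show P by (cases x rule: lgraph_exhaust; cases y rule: lgraph_exhaust) auto
qed auto
termination by (relation "measure (\<lambda>(x, y). gorder x + gorder y)") auto

definition hmult :: "'k::field hspace \<Rightarrow> 'k hspace \<Rightarrow> 'k hspace" where
  "hmult = bilin_ext gmult"

definition join_leaf :: "nat \<Rightarrow> lgraph \<Rightarrow> 'k::field hspace" where
  "join_leaf i x = (if i < gorder x \<and> i \<notin> loops x then basis (add_loop i x) else 0)"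

definition gdiff :: "lgraph \<Rightarrow> 'k::field hspace" where
  "gdiff x = (\<Sum>i = 0..gorder x. hscale ((-1) ^ (i + card {j \<in> loops x. j < i})) (join_leaf i x))"

definition hdiff :: "'k::field hspace \<Rightarrow> 'k hspace" where
  "hdiff = lin_ext gdiff"

lemma lin_ext_superset:
  assumes "finite A" "Poly_Mapping.keys u \<subseteq> A"
  shows "lin_ext f u = (\<Sum>x\<in>A. hscale (Poly_Mapping.lookup u x) (f x))"
  unfolding lin_ext_def using assms
  by (intro sum.mono_neutral_left) (auto simp: in_keys_iff)

lemma lin_ext_add: "lin_ext f (u + v) = lin_ext f u + lin_ext f v"
  using keys_add[of u v]
  by (simp add: lin_ext_superset[of "Poly_Mapping.keys u \<union> Poly_Mapping.keys v"] lookup_add hspace.scale_left_distrib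
      sum.distrib)

lemma lin_ext_scale: "lin_ext f (hscale c u) = hscale c (lin_ext f u)"
proof -
  have "Poly_Mapping.keys (hscale c u) \<subseteq> Poly_Mapping.keys u" by (auto simp: in_keys_iff)
  then show ?thesis
    by (simp add: lin_ext_superset[of "Poly_Mapping.keys u"] hspace.scale_sum_right)
qed

lemma lin_ext_0 [simp]: "lin_ext f 0 = 0"
  by (simp add: lin_ext_def)

lemma lin_ext_basis [simp]: "lin_ext f (basis x) = f x"
  by (simp add: lin_ext_def)

lemma lin_ext_add_fun: "lin_ext (\<lambda>x. f x + g x) u = lin_ext f u + lin_ext g u"
  by (simp add: lin_ext_def hspace.scale_right_distrib sum.distrib)

lemma lin_ext_scale_fun: "lin_ext (\<lambda>x. hscale c (f x)) u = hscale c (lin_ext f u)"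
  by (simp add: lin_ext_def hspace.scale_sum_right ac_simps)

lemma hspace_eq_lin_ext: "lin_ext basis u = u"
proof (rule poly_mapping_eqI)
  fix k
  have "Poly_Mapping.lookup (lin_ext basis u) k =
      (\<Sum>x\<in>Poly_Mapping.keys u. if x = k then Poly_Mapping.lookup u x else 0)"
    unfolding lin_ext_def lookup_sum lookup_hscale
    by (rule sum.cong) (auto simp: lookup_single when_def)
  also have "\<dots> = Poly_Mapping.lookup u k" by (simp add: in_keys_iff)
  finally show "Poly_Mapping.lookup (lin_ext basis u) k = Poly_Mapping.lookup u k" .
qed

lemma bilin_ext_simps:
  "bilin_ext f (u + u') v = bilin_ext f u v + bilin_ext f u' v"
  "bilin_ext f u (v + v') = bilin_ext f u v + bilin_ext f u v'"
  "bilin_ext f (hscale c u) v = hscale c (bilin_ext f u v)"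
  "bilin_ext f u (hscale c v) = hscale c (bilin_ext f u v)"
  "bilin_ext f 0 v = 0"
  "bilin_ext f u 0 = 0"
  "bilin_ext f (basis x) (basis y) = f x y"
  by (simp_all add: bilin_ext_def lin_ext_add lin_ext_scale lin_ext_add_fun lin_ext_scale_fun
      lin_ext_def[of "\<lambda>_. 0"])

lemmas hmult_simps = bilin_ext_simps[where f = gmult, folded hmult_def]
lemmas hgraft_simps = bilin_ext_simps[where f = "\<lambda>x y. basis (graft b x y)" for b, folded hgraft_def]
lemmas hdiff_simps = lin_ext_add[where f = gdiff, folded hdiff_def]
  lin_ext_scale[where f = gdiff, folded hdiff_def]

lemma hspace_induct [case_names zero add scale basis]:
  assumes "P 0" "\<And>u v. P u \<Longrightarrow> P v \<Longrightarrow> P (u + v)" "\<And>c u. P u \<Longrightarrow> P (hscale c u)" "\<And>x. P (basis x)"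
  shows "P (u :: 'k::field hspace)"
proof -
  have "P (\<Sum>x\<in>A. hscale (Poly_Mapping.lookup u x) (basis x))" if "finite A" for A
    using that by induction (auto intro: assms)
  then have "P (lin_ext basis u)" unfolding lin_ext_def by simp
  then show ?thesis by (simp add: hspace_eq_lin_ext)
qed

lemma gmult_bar [simp]: "gmult x bar = basis x"
  by (cases x rule: lgraph_exhaust) simp_all

lemma hmult_bar [simp]: "hmult (basis bar) u = u" "hmult u (basis bar) = u"
  by (induction u rule: hspace_induct) (simp_all add: hmult_simps)

lemma hmult_graft:
  "hmult (hgraft b (basis x1) (basis x2)) (hgraft c u v) =
     hgraft c (hmult (hgraft b (basis x1) (basis x2)) u) v +
     hgraft b (basis x1) (hmult (basis x2) (hgraft c u v))"
proof (induction u rule: hspace_induct)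
  case (basis y1)
  show ?case
    by (induction v rule: hspace_induct)
      (simp_all add: hmult_simps hgraft_simps hspace.scale_right_distrib)
qed (simp_all add: hmult_simps hgraft_simps hspace.scale_right_distrib)

lemma hmult_graft':
  "hmult (hgraft b w z) (hgraft c u v) =
     hgraft c (hmult (hgraft b w z) u) v + hgraft b w (hmult z (hgraft c u v))"
proof (induction w rule: hspace_induct)
  case (basis x1)
  show ?case
  proof (induction z rule: hspace_induct)
    case (basis x2)
    show ?case by (rule hmult_graft)
  qed (simp_all add: hmult_simps(1-6) hgraft_simps(1-6) hspace.scale_right_distrib)
qed (simp_all add: hmult_simps(1-6) hgraft_simps(1-6) hspace.scale_right_distrib)

lemma hmult_assoc_basis:
  "hmult (hmult (basis x) (basis y)) (basis z) =
   hmult (basis x) (hmult (basis y) (basis z :: 'k::field hspace))"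
proof (induction "gorder x + gorder y + gorder z" arbitrary: x y z rule: less_induct)
  case less
  show ?case
  proof (cases "x = bar \<or> y = bar \<or> z = bar")
    case True
    then show ?thesis by auto
  next
    case False
    then obtain a x1 x2 b y1 y2 c z1 z2
      where e: "x = graft a x1 x2" "y = graft b y1 y2" "z = graft c z1 z2"
      by (metis lgraph_exhaust)
    let ?B = "basis :: lgraph \<Rightarrow> 'k hspace"
    have g: "?B (graft d u v) = hgraft d (?B u) (?B v)" for d u v
      by (simp add: hgraft_simps)
    note IH = less[unfolded e]
    have 1: "hmult (hmult (?B (graft a x1 x2)) (?B (graft b y1 y2))) (?B z1) =
        hmult (?B (graft a x1 x2)) (hmult (?B (graft b y1 y2)) (?B z1))"
      by (rule IH) simp
    have 2: "hmult (hmult (?B x2) (?B (graft b y1 y2))) (?B (graft c z1 z2)) =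
        hmult (?B x2) (hmult (?B (graft b y1 y2)) (?B (graft c z1 z2)))"
      by (rule IH) simp
    let ?X = "?B (graft a x1 x2)" and ?Y = "?B (graft b y1 y2)" and ?Z = "?B (graft c z1 z2)"
    have m: "hmult (hgraft d p q) (hgraft d' p' q') = hgraft d' (hmult (hgraft d p q) p') q' +
        hgraft d p (hmult q (hgraft d' p' q'))" for d d' and p q p' q' :: "'k hspace"
      by (rule hmult_graft')
    have XY: "hmult ?X ?Y = hgraft b (hmult ?X (?B y1)) (?B y2) + hgraft a (?B x1) (hmult (?B x2) ?Y)"
      using m[of a "?B x1" "?B x2" b "?B y1" "?B y2"] by (simp only: g)
    have YZ: "hmult ?Y ?Z = hgraft c (hmult ?Y (?B z1)) (?B z2) + hgraft b (?B y1) (hmult (?B y2) ?Z)"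
      using m[of b "?B y1" "?B y2" c "?B z1" "?B z2"] by (simp only: g)
    have "hmult (hmult ?X ?Y) ?Z =
        hgraft c (hmult (hmult ?X ?Y) (?B z1)) (?B z2) +
        hgraft b (hmult ?X (?B y1)) (hmult (?B y2) ?Z) +
        hgraft a (?B x1) (hmult (hmult (?B x2) ?Y) ?Z)"
      unfolding XY hmult_simps(1) hgraft_simps(1)
      using m[of b "hmult ?X (?B y1)" "?B y2" c "?B z1" "?B z2"]
        m[of a "?B x1" "hmult (?B x2) ?Y" c "?B z1" "?B z2"]
      by (simp only: g[of c, symmetric] add_ac)
    moreover have "hmult ?X (hmult ?Y ?Z) =
        hgraft c (hmult ?X (hmult ?Y (?B z1))) (?B z2) +
        hgraft b (hmult ?X (?B y1)) (hmult (?B y2) ?Z) +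
        hgraft a (?B x1) (hmult (?B x2) (hmult ?Y ?Z))"
      unfolding YZ hmult_simps(2) hgraft_simps(2)
      using m[of a "?B x1" "?B x2" c "hmult ?Y (?B z1)" "?B z2"]
        m[of a "?B x1" "?B x2" b "?B y1" "hmult (?B y2) ?Z"]
      by (simp only: g[of a, symmetric] add_ac)
    ultimately show ?thesis using 1 2 unfolding e by simp
  qed
qed

lemma hmult_assoc: "hmult (hmult u v) w = hmult u (hmult v w)"
proof (induction u rule: hspace_induct)
  case (basis x)
  show ?case
  proof (induction v rule: hspace_induct)
    case (basis y)
    show ?case
      by (induction w rule: hspace_induct) (simp_all add: hmult_assoc_basis hmult_simps(1-6))
  qed (simp_all add: hmult_simps(1-6))
qed (simp_all add: hmult_simps(1-6))

definition irr_space :: "'k::field hspace set" where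
  "irr_space = hspace.span (basis ` {x. irregular x})"

definition layer :: "nat \<Rightarrow> nat set \<Rightarrow> 'k::field hspace set" where
  "layer n S = hspace.span (basis ` {x. gorder x = n \<and> loops x = S})"

lemma subspace_irr_space: "hspace.subspace irr_space"
  by (simp add: irr_space_def)

lemma basis_irr_space: "irregular x \<Longrightarrow> basis x \<in> irr_space"
  by (simp add: irr_space_def hspace.span_base)

lemma basis_layer: "gorder x = n \<Longrightarrow> loops x = S \<Longrightarrow> basis x \<in> layer n S"
  by (simp add: layer_def hspace.span_base)

lemma layer_irr_space:
  assumes "i \<in> S" "Suc i \<in> S" shows "layer n S \<subseteq> irr_space"
  unfolding layer_def irr_space_def using assms
  by (intro hspace.span_mono image_mono) (auto simp: irregular_def)

lemma hspace_linear_image_span: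
  assumes "\<And>u v. F (u + v) = F u + F v" "\<And>c u. F (hscale c u) = hscale c (F u)" "F 0 = 0"
    and "\<And>x. x \<in> B \<Longrightarrow> F x \<in> T" "hspace.subspace T" "u \<in> hspace.span B"
  shows "F u \<in> T"
proof -
  have "hspace.subspace {u. F u \<in> T}"
    using assms(5) by (simp add: hspace.subspace_def assms(1-3))
  then have "hspace.span B \<subseteq> {u. F u \<in> T}"
    using assms(4) by (intro hspace.span_minimal) auto
  then show ?thesis using assms(6) by auto
qed

lemma hgraft_layer:
  assumes u: "u \<in> layer m S" and v: "v \<in> layer n T"
  shows "hgraft b u v \<in>
    layer (m + n + 1) (S \<union> (if b then {m} else {}) \<union> (\<lambda>i. i + m + 1) ` T)" (is "_ \<in> ?L")
proof -
  have L: "hspace.subspace ?L" by (simp add: layer_def)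
  have "hgraft b (basis x) v \<in> ?L" if "gorder x = m" "loops x = S" for x
    by (rule hspace_linear_image_span[OF _ _ _ _ L v[unfolded layer_def]])
      (auto simp: hgraft_simps that loops_graft intro!: basis_layer)
  then show ?thesis
    by (intro hspace_linear_image_span[where F = "\<lambda>u. hgraft b u v", OF _ _ _ _ L u[unfolded layer_def]])
      (auto simp: hgraft_simps(1-6))
qed

lemma gmult_layer:
  "(gmult x y :: 'k::field hspace) \<in> layer (gorder x + gorder y) (loops x \<union> (\<lambda>i. i + gorder x) ` loops y)"
proof (induction x y rule: gmult.induct)
  case (3 b x1 x2 c y1 y2)
  let ?L = "layer (gorder (graft b x1 x2) + gorder (graft c y1 y2))
    (loops (graft b x1 x2) \<union> (\<lambda>i. i + gorder (graft b x1 x2)) ` loops (graft c y1 y2))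
    :: 'k hspace set"
  have "(hgraft c (gmult (graft b x1 x2) y1) (basis y2) :: 'k hspace) \<in> ?L"
  proof -
    have "(hgraft c (gmult (graft b x1 x2) y1) (basis y2) :: 'k hspace) \<in> layer
        (gorder (graft b x1 x2) + gorder y1 + gorder y2 + 1)
        ((loops (graft b x1 x2) \<union> (\<lambda>i. i + gorder (graft b x1 x2)) ` loops y1) \<union>
          (if c then {gorder (graft b x1 x2) + gorder y1} else {}) \<union>
          (\<lambda>i. i + (gorder (graft b x1 x2) + gorder y1) + 1) ` loops y2)"
      by (rule hgraft_layer[OF 3(1)]) (simp add: basis_layer)
    also have "\<dots> = ?L"
      unfolding loops_graft[of c] image_Un image_image gorder_graft
      by (intro arg_cong2[where f = layer]) (cases c; simp add: ac_simps)+
    finally show ?thesis .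
  qed
  moreover have "(hgraft b (basis x1) (gmult x2 (graft c y1 y2)) :: 'k hspace) \<in> ?L"
  proof -
    have "(hgraft b (basis x1) (gmult x2 (graft c y1 y2)) :: 'k hspace) \<in> layer
        (gorder x1 + (gorder x2 + gorder (graft c y1 y2)) + 1)
        (loops x1 \<union> (if b then {gorder x1} else {}) \<union> (\<lambda>i. i + gorder x1 + 1) `
          (loops x2 \<union> (\<lambda>i. i + gorder x2) ` loops (graft c y1 y2)))"
      by (rule hgraft_layer[OF _ 3(2)]) (simp add: basis_layer)
    also have "\<dots> = ?L"
      unfolding loops_graft[of b] image_Un image_image gorder_graft
      by (intro arg_cong2[where f = layer]) (simp_all add: ac_simps)
    finally show ?thesis .
  qed
  ultimately show ?case
    unfolding gmult.simps layer_def by (rule hspace.span_add)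
qed (auto intro!: basis_layer)

lemma hmult_irr_space:
  assumes "u \<in> irr_space"
  shows "hmult u v \<in> irr_space" "hmult v u \<in> irr_space"
proof -
  have 1: "gmult x y \<in> irr_space" if irr: "irregular x \<or> irregular y" for x y
  proof -
    obtain i where "i \<in> loops x \<union> (\<lambda>i. i + gorder x) ` loops y"
      "Suc i \<in> loops x \<union> (\<lambda>i. i + gorder x) ` loops y"
    proof (cases "irregular x")
      case True
      then show thesis using that by (auto simp: irregular_def)
    next
      case False
      with irr obtain i where "i \<in> loops y" "Suc i \<in> loops y" by (auto simp: irregular_def)
      then show thesis using that[of "i + gorder x"] by (force simp: image_iff)
    qed
    from layer_irr_space[OF this] gmult_layer show ?thesis by blast
  qed
  note S = subspace_irr_space and U = assms[unfolded irr_space_def]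
  show "hmult u v \<in> irr_space"
  proof (rule hspace_linear_image_span[where F = "\<lambda>u. hmult u v", OF _ _ _ _ S U])
    fix w :: "'a hspace" assume "w \<in> basis ` {x. irregular x}"
    then obtain x where x: "w = basis x" "irregular x" by auto
    show "hmult w v \<in> irr_space" unfolding x
      by (induction v rule: hspace_induct)
        (use x(2) in \<open>auto simp: hmult_simps 1 S[THEN hspace.subspace_0]
          S[THEN hspace.subspace_add] S[THEN hspace.subspace_scale]\<close>)
  qed (simp_all add: hmult_simps)
  show "hmult v u \<in> irr_space"
  proof (rule hspace_linear_image_span[where F = "\<lambda>u. hmult v u", OF _ _ _ _ S U])
    fix w :: "'a hspace" assume "w \<in> basis ` {x. irregular x}"
    then obtain x where x: "w = basis x" "irregular x" by auto
    show "hmult v w \<in> irr_space" unfolding x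
      by (induction v rule: hspace_induct)
        (use x(2) in \<open>auto simp: hmult_simps 1 S[THEN hspace.subspace_0]
          S[THEN hspace.subspace_add] S[THEN hspace.subspace_scale]\<close>)
  qed (simp_all add: hmult_simps)
qed

lemma hdiff_irr_space:
  assumes "u \<in> irr_space"
  shows "hdiff u \<in> irr_space"
proof (rule hspace_linear_image_span[OF _ _ _ _ subspace_irr_space assms[unfolded irr_space_def]])
  fix w :: "'a hspace" assume "w \<in> basis ` {x. irregular x}"
  then obtain x where x: "w = basis x" "irregular x" by auto
  have "join_leaf i x \<in> irr_space" for i
    using x(2) by (auto simp: join_leaf_def irregular_def loops_add_loop
        intro!: basis_irr_space subspace_irr_space[THEN hspace.subspace_0])
  then show "hdiff w \<in> irr_space"
    unfolding x hdiff_def lin_ext_basis gdiff_def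
    by (intro hspace.subspace_sum[OF subspace_irr_space]
        hspace.subspace_scale[OF subspace_irr_space])
qed (simp_all add: hdiff_simps, simp add: hdiff_def)

lemma irr_space_lookup:
  assumes "u \<in> irr_space" "\<not> irregular x"
  shows "Poly_Mapping.lookup u x = 0"
proof -
  have "hspace.subspace {u. Poly_Mapping.lookup u x = (0 :: 'a)}"
    by (auto simp: hspace.subspace_def lookup_add)
  then have "irr_space \<subseteq> {u. Poly_Mapping.lookup u x = (0 :: 'a)}"
    unfolding irr_space_def
    by (rule hspace.span_minimal[rotated]) (use assms(2) in \<open>auto simp: lookup_single when_def\<close>)
  then show ?thesis using assms(1) by auto
qed

definition irr_rel :: "'k::field hspace \<Rightarrow> 'k hspace \<Rightarrow> bool" where
  "irr_rel u v \<longleftrightarrow> u - v \<in> irr_space"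

lemma irr_space_closed:
  "0 \<in> irr_space"
  "u \<in> irr_space \<Longrightarrow> v \<in> irr_space \<Longrightarrow> u + v \<in> irr_space"
  "u \<in> irr_space \<Longrightarrow> v \<in> irr_space \<Longrightarrow> u - v \<in> irr_space"
  "u \<in> irr_space \<Longrightarrow> - u \<in> irr_space"
  "u \<in> irr_space \<Longrightarrow> hscale c u \<in> irr_space"
  using subspace_irr_space
  by (auto intro: hspace.subspace_0 hspace.subspace_add hspace.subspace_diff hspace.subspace_neg
      hspace.subspace_scale)

quotient_type (overloaded) 'k areg = "'k::field hspace" / irr_rel
proof (rule equivpI)
  show "reflp irr_rel" by (auto simp: reflp_def irr_rel_def irr_space_closed)
  show "symp irr_rel"
    using irr_space_closed(4) by (fastforce simp: symp_def irr_rel_def)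
  show "transp irr_rel"
    using irr_space_closed(2) by (fastforce simp: transp_def irr_rel_def)
qed

lemma hmult_diff: "hmult (u - v) w = hmult u w - hmult v w" "hmult w (u - v) = hmult w u - hmult w v"
  using hmult_simps(1)[of "u - v" v w] hmult_simps(2)[of w "u - v" v] by simp_all

lemma hdiff_diff: "hdiff (u - v) = hdiff u - hdiff v"
  using hdiff_simps(1)[of "u - v" v] by simp

instantiation areg :: (field) ring_1
begin

lift_definition zero_areg :: "'a areg" is 0 .

lift_definition one_areg :: "'a areg" is "basis bar" .

lift_definition plus_areg :: "'a areg \<Rightarrow> 'a areg \<Rightarrow> 'a areg" is "(+)"
  unfolding irr_rel_def by (metis add_diff_add irr_space_closed(2))

lift_definition minus_areg :: "'a areg \<Rightarrow> 'a areg \<Rightarrow> 'a areg" is "(-)"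
proof -
  fix u u' v v' :: "'a hspace" assume "irr_rel u u'" "irr_rel v v'"
  then have "(u - u') - (v - v') \<in> irr_space" by (simp add: irr_rel_def irr_space_closed)
  then show "irr_rel (u - v) (u' - v')" by (simp add: irr_rel_def algebra_simps)
qed

lift_definition uminus_areg :: "'a areg \<Rightarrow> 'a areg" is uminus
proof -
  fix u v :: "'a hspace" assume "irr_rel u v"
  then have "- (u - v) \<in> irr_space" unfolding irr_rel_def by (rule irr_space_closed)
  then show "irr_rel (- u) (- v)" by (simp add: irr_rel_def)
qed

lift_definition times_areg :: "'a areg \<Rightarrow> 'a areg \<Rightarrow> 'a areg" is hmult
proof -
  fix u u' v v' :: "'a hspace" assume "irr_rel u u'" "irr_rel v v'"
  then have "hmult (u - u') v + hmult u' (v - v') \<in> irr_space"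
    by (simp add: irr_rel_def irr_space_closed hmult_irr_space)
  then show "irr_rel (hmult u v) (hmult u' v')" by (simp add: irr_rel_def hmult_diff)
qed

instance
proof
  have "(basis bar :: 'a hspace) \<notin> irr_space"
    using irr_space_lookup[of "basis bar :: 'a hspace" bar] by (auto simp: irregular_def)
  then have "- (basis bar :: 'a hspace) \<notin> irr_space"
    using irr_space_closed(4)[of "- basis bar :: 'a hspace"] by auto
  then show "(0 :: 'a areg) \<noteq> 1"
    by transfer (simp add: irr_rel_def)
qed (transfer; simp add: irr_rel_def irr_space_closed hmult_assoc hmult_simps algebra_simps)+

end

lift_definition ascale :: "'k::field \<Rightarrow> 'k areg \<Rightarrow> 'k areg" is hscale
  unfolding irr_rel_def by (simp add: irr_space_closed flip: hspace.scale_right_diff_distrib)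

interpretation areg: vector_space ascale
  by standard (transfer; simp add: irr_rel_def irr_space_closed hspace.scale_right_distrib
    hspace.scale_left_distrib)+

lemma ascale_mult: "ascale c x * y = ascale c (x * y)" "x * ascale c y = ascale c (x * y)"
  by (transfer; simp add: irr_rel_def irr_space_closed hmult_simps)+

lift_definition adiff :: "'k::field areg \<Rightarrow> 'k areg" is hdiff
  unfolding irr_rel_def by (simp add: hdiff_irr_space flip: hdiff_diff)

abbreviation graph_class :: "lgraph \<Rightarrow> 'k::field areg" where
  "graph_class x \<equiv> abs_areg (basis x)"

definition tau :: "'k::field areg" where
  "tau = graph_class (graft False bar bar)"

definition ell :: "'k::field areg" where
  "ell = graph_class (graft True bar bar)"

text \<open>The generated subalgebra is unital; its unit is the class of the tree without vertices.\<close>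

inductive_set toprec :: "'k::field areg set" where
  one: "1 \<in> toprec"
| tau: "tau \<in> toprec"
| ell: "ell \<in> toprec"
| add: "x \<in> toprec \<Longrightarrow> y \<in> toprec \<Longrightarrow> x + y \<in> toprec"
| scale: "x \<in> toprec \<Longrightarrow> ascale c x \<in> toprec"
| mult: "x \<in> toprec \<Longrightarrow> y \<in> toprec \<Longrightarrow> x * y \<in> toprec"

text \<open>The number of loops \<open>g\<close> is an integer so that \<open>g - 1\<close> is meaningful for \<open>g = 0\<close>, where the
  component of degree \<open>g - 1\<close> is zero.\<close>

definition bidegree :: "nat \<Rightarrow> int \<Rightarrow> 'k::field areg set" where
  "bidegree n g = areg.span {graph_class x | x. gorder x = n \<and> int (card (loops x)) = g}"

definition toprec_deg :: "nat \<Rightarrow> int \<Rightarrow> 'k::field areg set" where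
  "toprec_deg n g = toprec \<inter> bidegree n g"

definition cocycles :: "nat \<Rightarrow> int \<Rightarrow> 'k::field areg set" where
  "cocycles n g = {x \<in> toprec_deg n g. adiff x = 0}"

definition coboundaries :: "nat \<Rightarrow> int \<Rightarrow> 'k::field areg set" where
  "coboundaries n g = {x \<in> toprec_deg n g. \<exists>s \<in> toprec_deg n (g - 1). x = adiff s}"

text \<open>The quotient vector space \<open>V / U\<close> for subspaces \<open>U \<subseteq> V\<close> of the ambient algebra: its elements
  are the cosets of \<open>U\<close> by elements of \<open>V\<close>. The operations are given on arbitrary sets by formulas
  that depend on \<open>U\<close> only and are the induced ones on cosets (see \<open>quotient_operations\<close>), so
  that an equality of such records is an equality of quotient vector spaces.\<close>

record ('k, 'v) quot_space =
  cosets :: "'v set set"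
  coset_zero :: "'v set"
  coset_add :: "'v set \<Rightarrow> 'v set \<Rightarrow> 'v set"
  coset_scale :: "'k \<Rightarrow> 'v set \<Rightarrow> 'v set"

definition coset :: "'k::field areg \<Rightarrow> 'k areg set \<Rightarrow> 'k areg set" where
  "coset x U = {x + u | u. u \<in> U}"

definition quotient_space :: "'k::field areg set \<Rightarrow> 'k areg set \<Rightarrow> ('k, 'k areg) quot_space" where
  "quotient_space V U =
     \<lparr>cosets = {coset x U | x. x \<in> V},
      coset_zero = U,
      coset_add = (\<lambda>C D. {x + y | x y. x \<in> C \<and> y \<in> D}),
      coset_scale = (\<lambda>c C. {ascale c x + u | x u. x \<in> C \<and> u \<in> U})\<rparr>"

lemma quotient_operations:
  assumes U: "areg.subspace U"
  shows "coset_add (quotient_space V U) (coset x U) (coset y U) = coset (x + y) U"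
    and "coset_scale (quotient_space V U) c (coset x U) = coset (ascale c x) U"
    and "coset_zero (quotient_space V U) = coset 0 U"
proof -
  show "coset_add (quotient_space V U) (coset x U) (coset y U) = coset (x + y) U" (is "?l = ?r")
  proof
    show "?l \<subseteq> ?r"
    proof
      fix z assume "z \<in> ?l"
      then obtain u v where "u \<in> U" "v \<in> U" "z = (x + u) + (y + v)"
        by (auto simp: quotient_space_def coset_def)
      then show "z \<in> ?r"
        using areg.subspace_add[OF U, of u v] by (auto simp: coset_def algebra_simps)
    qed
    show "?r \<subseteq> ?l"
    proof
      fix z assume "z \<in> ?r"
      then obtain u where "u \<in> U" "z = (x + 0) + (y + u)"
        by (auto simp: coset_def algebra_simps)
      then show "z \<in> ?l"
        using areg.subspace_0[OF U] by (fastforce simp: quotient_space_def coset_def)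
    qed
  qed
  show "coset_scale (quotient_space V U) c (coset x U) = coset (ascale c x) U" (is "?l = ?r")
  proof
    show "?l \<subseteq> ?r"
    proof
      fix z assume "z \<in> ?l"
      then obtain u v where "u \<in> U" "v \<in> U" "z = ascale c (x + u) + v"
        by (auto simp: quotient_space_def coset_def)
      then show "z \<in> ?r"
        using areg.subspace_add[OF U areg.subspace_scale[OF U, of u c], of v]
        by (auto simp: coset_def areg.scale_right_distrib add.assoc)
    qed
    show "?r \<subseteq> ?l"
    proof
      fix z assume "z \<in> ?r"
      then obtain u where "u \<in> U" "z = ascale c (x + 0) + u"
        by (auto simp: coset_def)
      then show "z \<in> ?l"
        using areg.subspace_0[OF U] by (fastforce simp: quotient_space_def coset_def)
    qed
  qed
  show "coset_zero (quotient_space V U) = coset 0 U"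
    by (simp add: quotient_space_def coset_def)
qed

definition cohomology :: "nat \<Rightarrow> int \<Rightarrow> ('k::field, 'k areg) quot_space" where
  "cohomology n g = quotient_space (cocycles n g) (coboundaries n g)"

end

theory Submission
  imports Defs
begin

text \<open>
  A graph of order two has three leaves, so if it carries two loops, they share the middle leaf and
  the graph is irregular. Hence \<open>adiff\<close> vanishes on all of bidegree \<open>(2, 1)\<close>
  (\<open>adiff_order_two_one_loop\<close>), every element is a cocycle, and the cohomology is the whole
  component modulo coboundaries.

  Coboundaries come from bidegree \<open>(2, 0)\<close>. There are two loop-free graphs of order two, the left
  and the right comb, but the subalgebra contains only the multiples of their sum
  \<open>tau * tau\<close> (\<open>toprec_deg_2_0\<close>). The reason is that the coefficient of a comb in a product only
  sees the constant terms, the coefficients of \<open>tau\<close> and the coefficients of the same comb in the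
  factors, and it does so by the same formula for both combs (\<open>reg_coeff_times\<close>). So the elements
  in which the two combs have equal coefficients form a subalgebra, which contains \<open>tau\<close> and
  \<open>ell\<close>. Finally \<open>adiff (tau * tau) = ell * tau - tau * ell\<close>: joining the first two leaves of both
  combs gives \<open>ell * tau\<close>, joining the last two gives \<open>tau * ell\<close>, and these enter with opposite
  signs.
\<close>

abbreviation tau_graph :: lgraph where "tau_graph \<equiv> graft False bar bar"

abbreviation ell_graph :: lgraph where "ell_graph \<equiv> graft True bar bar"

abbreviation left_comb :: lgraph where "left_comb \<equiv> graft False tau_graph bar"

abbreviation right_comb :: lgraph where "right_comb \<equiv> graft False bar tau_graph"

section \<open>Graphs of order at most two\<close>

lemma gorder_eq_0_iff [simp]: "gorder x = 0 \<longleftrightarrow> x = bar"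
  by (cases x rule: lgraph_exhaust) auto

lemma loop_free_order_one:
  assumes "gorder x = Suc 0" "loops x = {}"
  shows "x = tau_graph"
  using assms by (cases x rule: lgraph_exhaust) (auto simp: loops_graft split: if_splits)

lemma loop_free_order_two_iff:
  "gorder x = 2 \<and> loops x = {} \<longleftrightarrow> x = left_comb \<or> x = right_comb"
proof
  assume x: "gorder x = 2 \<and> loops x = {}"
  then obtain b y z where e: "x = graft b y z"
    by (cases x rule: lgraph_exhaust) auto
  from x e have "\<not> b" "loops y = {}" "loops z = {}" "gorder y + gorder z = 1"
    by (auto simp: loops_graft split: if_splits)
  then show "x = left_comb \<or> x = right_comb"
    unfolding e by (cases "gorder y") (auto dest: loop_free_order_one)
qed (auto simp: loops_graft)

lemma tree_of_add_loop [simp]: "tree_of (add_loop i x) = tree_of x"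
  by transfer (auto split: prod.splits)

lemma irregular_order_two:
  assumes "gorder x = 2" "loops x \<noteq> {}" "i < 2" "i \<notin> loops x"
  shows "irregular (add_loop i x)"
proof -
  from assms(2) obtain j where "j \<in> loops x" by auto
  moreover from this have "j < 2" using loops_subset[of x] assms(1) by auto
  ultimately have "0 \<in> loops (add_loop i x)" "Suc 0 \<in> loops (add_loop i x)"
    using assms by (auto simp: loops_add_loop less_2_cases_iff)
  then show ?thesis unfolding irregular_def by blast
qed

section \<open>The linear structure of the quotient\<close>

lemma abs_areg_add: "abs_areg (u + v) = abs_areg u + abs_areg v"
  by (simp add: plus_areg.abs_eq)

lemma abs_areg_diff: "abs_areg (u - v) = abs_areg u - abs_areg v"
  by (simp add: minus_areg.abs_eq)

lemma adiff_add: "adiff (x + y) = adiff x + adiff y"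
  by transfer (simp add: hdiff_simps irr_rel_def irr_space_closed)

lemma adiff_scale: "adiff (ascale c x) = ascale c (adiff x)"
  by transfer (simp add: hdiff_simps irr_rel_def irr_space_closed)

lemma adiff_0 [simp]: "adiff 0 = 0"
  using adiff_scale[of 0 0] by simp

text \<open>Coefficients of regular graphs are well defined modulo irregular graphs; those of irregular
  graphs are not, and get the value 0.\<close>

lift_definition reg_coeff :: "lgraph \<Rightarrow> 'k::field areg \<Rightarrow> 'k"
  is "\<lambda>g u. if irregular g then 0 else Poly_Mapping.lookup u g"
  unfolding irr_rel_def using irr_space_lookup by (fastforce simp: lookup_minus)

lemma reg_coeff_add: "reg_coeff g (x + y) = reg_coeff g x + reg_coeff g y"
  by transfer (simp add: lookup_add)

lemma reg_coeff_scale: "reg_coeff g (ascale c x) = c * reg_coeff g x"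
  by transfer simp

lemma reg_coeff_graph_class:
  "\<not> irregular g \<Longrightarrow> reg_coeff g (graph_class x) = (if x = g then 1 else 0)"
  by (simp add: reg_coeff.abs_eq lookup_single when_def)

section \<open>Coefficients of products\<close>

lemma layer_lookup:
  assumes "u \<in> layer n S" "\<not> (gorder g = n \<and> loops g = S)"
  shows "Poly_Mapping.lookup u g = 0"
proof -
  have "hspace.subspace {u. Poly_Mapping.lookup u g = (0 :: 'a)}"
    by (auto simp: hspace.subspace_def lookup_add)
  then have "layer n S \<subseteq> {u. Poly_Mapping.lookup u g = (0 :: 'a)}"
    unfolding layer_def
    by (rule hspace.span_minimal[rotated]) (use assms(2) in \<open>auto simp: lookup_single when_def split: if_splits\<close>)
  then show ?thesis using assms(1) by auto
qed

lemma gmult_tau_tau: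
  "gmult tau_graph tau_graph = (basis left_comb + basis right_comb :: 'k::field hspace)"
  by (simp add: hgraft_simps)

text \<open>The product adds orders and concatenates loop sets (\<open>gmult_layer\<close>), so a loop-free graph of
  order two only arises from loop-free factors of orders \<open>0 + 2\<close>, \<open>1 + 1\<close> or \<open>2 + 0\<close>.\<close>

lemma gmult_lookup_comb:
  assumes g: "g = left_comb \<or> g = right_comb"
  shows "Poly_Mapping.lookup (gmult x y :: 'k::field hspace) g =
    (if x = bar \<and> y = g then 1 else 0) + (if x = tau_graph \<and> y = tau_graph then 1 else 0) +
    (if x = g \<and> y = bar then 1 else 0)"
proof -
  have g2: "gorder g = 2" "loops g = {}" using g loop_free_order_two_iff by blast+
  consider "x = bar" | "y = bar" | "x = tau_graph" "y = tau_graph" |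
    "x \<noteq> bar" "y \<noteq> bar" "\<not> (x = tau_graph \<and> y = tau_graph)" by blast
  then show ?thesis
  proof cases
    case 3
    show ?thesis unfolding 3 gmult_tau_tau using g by (auto simp: lookup_add lookup_single when_def)
  next
    case 4
    have "\<not> (gorder g = gorder x + gorder y \<and> loops g = loops x \<union> (\<lambda>i. i + gorder x) ` loops y)"
    proof
      assume a: "gorder g = gorder x + gorder y \<and> loops g = loops x \<union> (\<lambda>i. i + gorder x) ` loops y"
      moreover have "gorder x \<noteq> 0" "gorder y \<noteq> 0" using 4 by simp_all
      ultimately have "gorder x = Suc 0" "gorder y = Suc 0" "loops x = {}" "loops y = {}"
        using g2 by (linarith | blast)+
      then show False using 4(3) loop_free_order_one by blast
    qed
    from layer_lookup[OF gmult_layer this] 4 show ?thesis by auto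
  qed (use g in \<open>auto simp: lookup_single when_def\<close>)
qed

lemma hmult_lookup_comb:
  assumes g: "g = left_comb \<or> g = right_comb"
  shows "Poly_Mapping.lookup (hmult u v) g =
    Poly_Mapping.lookup u bar * Poly_Mapping.lookup v g +
    Poly_Mapping.lookup u tau_graph * Poly_Mapping.lookup v tau_graph +
    Poly_Mapping.lookup u g * Poly_Mapping.lookup v bar"
proof (induction u rule: hspace_induct)
  case (basis x)
  show ?case
  proof (induction v rule: hspace_induct)
    case (basis y)
    show ?case
      unfolding hmult_simps(7) gmult_lookup_comb[OF g]
      by (auto simp: lookup_single when_def)
  qed (simp_all add: hmult_simps(1-6) lookup_add algebra_simps)
qed (simp_all add: hmult_simps(1-6) lookup_add algebra_simps)

lemma regular_low_order:
  "\<not> irregular bar" "\<not> irregular tau_graph" "\<not> irregular ell_graph"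
  "\<not> irregular left_comb" "\<not> irregular right_comb"
  by (auto simp: irregular_def loops_graft)

lemma reg_coeff_times:
  assumes g: "g = left_comb \<or> g = right_comb"
  shows "reg_coeff g (x * y) = reg_coeff bar x * reg_coeff g y +
    reg_coeff tau_graph x * reg_coeff tau_graph y + reg_coeff g x * reg_coeff bar y"
proof -
  have "\<not> irregular g" using g regular_low_order by blast
  then show ?thesis
    by (transfer fixing: g) (simp add: regular_low_order hmult_lookup_comb[OF g])
qed

text \<open>This separates the generated subalgebra from the full algebra of regular graphs. It survives
  products because \<open>reg_coeff_times\<close> has the same shape for both combs.\<close>

lemma toprec_comb_coeffs_eq:
  "x \<in> toprec \<Longrightarrow> reg_coeff left_comb x = reg_coeff right_comb x"
proof (induction rule: toprec.induct)
  case one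
  show ?case
    by (simp add: one_areg_def reg_coeff_graph_class regular_low_order)
qed (simp_all add: tau_def ell_def reg_coeff_graph_class regular_low_order reg_coeff_add
    reg_coeff_scale reg_coeff_times)

section \<open>Products of generators and their differential\<close>

lemma tau_times_tau: "tau * tau = graph_class left_comb + graph_class right_comb"
  by (simp add: tau_def times_areg.abs_eq hmult_simps hgraft_simps abs_areg_add)

lemma ell_times_tau:
  "ell * tau = graph_class (graft False ell_graph bar) + graph_class (graft True bar tau_graph)"
  by (simp add: tau_def ell_def times_areg.abs_eq hmult_simps hgraft_simps abs_areg_add)

lemma tau_times_ell:
  "tau * ell = graph_class (graft True tau_graph bar) + graph_class (graft False bar ell_graph)"
  by (simp add: tau_def ell_def times_areg.abs_eq hmult_simps hgraft_simps abs_areg_add)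

lemma gdiff_loop_free_order_two:
  assumes "gorder x = 2" "loops x = {}"
  shows "gdiff x = basis (add_loop 0 x) - (basis (add_loop 1 x) :: 'k::field hspace)"
proof -
  have "hscale (- 1) u = - u" for u :: "'k hspace" by simp
  then show ?thesis
    using assms by (simp add: gdiff_def join_leaf_def numeral_2_eq_2)
qed

lemma add_loop_combs:
  "add_loop 0 left_comb = graft False ell_graph bar"
  "add_loop 1 left_comb = graft True tau_graph bar"
  "add_loop 0 right_comb = graft True bar tau_graph"
  "add_loop 1 right_comb = graft False bar ell_graph"
  by (rule lgraph_eqI; simp add: loops_add_loop loops_graft)+

lemma adiff_tau_times_tau: "adiff (tau * tau) = ell * tau - tau * (ell :: 'k::field areg)"
proof -
  have d: "adiff (graph_class x) = graph_class (add_loop 0 x) - (graph_class (add_loop 1 x) :: 'k areg)"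
    if "x = left_comb \<or> x = right_comb" for x
    using that loop_free_order_two_iff[of x]
    by (simp add: adiff.abs_eq hdiff_def gdiff_loop_free_order_two abs_areg_diff)
  show ?thesis
    by (simp add: tau_times_tau adiff_add d add_loop_combs[simplified] ell_times_tau tau_times_ell)
qed

text \<open>Every term of the differential has a second loop, hence is irregular.\<close>

lemma adiff_order_two_one_loop:
  assumes "x \<in> bidegree 2 1"
  shows "adiff x = 0"
  using assms unfolding bidegree_def
proof (induction rule: areg.span_induct_alt)
  case base
  show ?case by simp
next
  case (step c x y)
  then obtain g where g: "x = graph_class g" "gorder g = 2" "card (loops g) = 1"
    by auto
  then have "loops g \<noteq> {}" by auto
  then have "(join_leaf i g :: 'a hspace) \<in> irr_space" for i
    using g irregular_order_two[of g i]
    by (auto simp: join_leaf_def intro!: basis_irr_space irr_space_closed(1))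
  then have "(gdiff g :: 'a hspace) \<in> irr_space"
    unfolding gdiff_def
    by (intro hspace.subspace_sum[OF subspace_irr_space] irr_space_closed(5))
  then have "adiff x = 0"
    unfolding g by (simp add: adiff.abs_eq hdiff_def zero_areg_def areg.abs_eq_iff irr_rel_def)
  then show ?case by (simp add: adiff_add adiff_scale step)
qed

section \<open>Cocycles and coboundaries\<close>

lemma graph_class_bidegree:
  "gorder x = n \<Longrightarrow> int (card (loops x)) = g \<Longrightarrow> graph_class x \<in> bidegree n g"
  unfolding bidegree_def by (rule areg.span_base) auto

lemma subspace_toprec_deg: "areg.subspace (toprec_deg n g)"
proof -
  have "areg.subspace toprec"
    using toprec.scale[OF toprec.one, of 0]
    by (auto simp: areg.subspace_def intro: toprec.add toprec.scale)
  then show ?thesis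
    unfolding toprec_deg_def bidegree_def by (intro areg.subspace_inter areg.subspace_span)
qed

text \<open>Bidegree \<open>(2, 0)\<close> of the full algebra is spanned by the two combs; equality of their
  coefficients cuts it down to the line through their sum.\<close>

lemma toprec_deg_2_0: "toprec_deg 2 0 = areg.span {tau * (tau :: 'k::field areg)}"
proof
  have "graph_class left_comb + graph_class right_comb \<in> (bidegree 2 0 :: 'k areg set)"
    unfolding bidegree_def
    by (intro areg.span_add; fold bidegree_def; intro graph_class_bidegree) (simp_all add: loops_graft)
  then have "tau * tau \<in> (toprec_deg 2 0 :: 'k areg set)"
    by (simp add: toprec_deg_def tau_times_tau[symmetric] toprec.tau toprec.mult)
  then show "areg.span {tau * tau} \<subseteq> (toprec_deg 2 0 :: 'k areg set)"
    by (intro areg.span_minimal subspace_toprec_deg) simp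
  show "toprec_deg 2 0 \<subseteq> areg.span {tau * (tau :: 'k areg)}"
  proof
    fix x :: "'k areg" assume x: "x \<in> toprec_deg 2 0"
    have "finite (loops y)" for y
      using loops_subset[of y] finite_subset by blast
    then have "{graph_class y |y. gorder y = 2 \<and> int (card (loops y)) = 0} =
        {graph_class left_comb, graph_class right_comb :: 'k areg}"
      using loop_free_order_two_iff by auto
    with x have "x \<in> areg.span {graph_class left_comb, graph_class right_comb}"
      by (simp add: toprec_deg_def bidegree_def)
    then obtain a b where e: "x = ascale a (graph_class left_comb) + ascale b (graph_class right_comb)"
      by (auto simp: areg.span_breakdown_eq algebra_simps)
    have "a = reg_coeff left_comb x" "b = reg_coeff right_comb x"
      by (simp_all add: e reg_coeff_add reg_coeff_scale reg_coeff_graph_class regular_low_order)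
    then have "a = b" using toprec_comb_coeffs_eq x by (auto simp: toprec_deg_def)
    then have "x = ascale a (tau * tau)"
      by (simp add: e tau_times_tau areg.scale_right_distrib)
    then show "x \<in> areg.span {tau * tau}" by (simp add: areg.span_base areg.span_scale)
  qed
qed

lemma cocycles_2_1: "cocycles 2 1 = toprec_deg 2 1"
  by (auto simp: cocycles_def toprec_deg_def adiff_order_two_one_loop)

lemma coboundaries_2_1:
  "coboundaries 2 1 = areg.span {ell * tau - tau * (ell :: 'k::field areg)}"
proof -
  let ?B = "bidegree 2 1 :: 'k areg set"
  have "ell * tau \<in> ?B" "tau * ell \<in> ?B"
    unfolding ell_times_tau tau_times_ell bidegree_def
    by (intro areg.span_add; fold bidegree_def; intro graph_class_bidegree;
        simp add: loops_graft)+
  then have "ell * tau \<in> (toprec_deg 2 1 :: 'k areg set)" "tau * ell \<in> (toprec_deg 2 1 :: 'k areg set)"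
    by (simp_all add: toprec_deg_def toprec.mult toprec.tau toprec.ell)
  then have d: "ascale c (ell * tau - tau * ell) \<in> (toprec_deg 2 1 :: 'k areg set)" for c
    by (intro areg.subspace_scale[OF subspace_toprec_deg] areg.subspace_diff[OF subspace_toprec_deg])
  show ?thesis
    unfolding coboundaries_def diff_self toprec_deg_2_0 areg.span_singleton
    using d by (auto simp: adiff_scale adiff_tau_times_tau)
qed

theorem theorem4:
  "(cohomology 2 1 :: ('k::field_char_0, 'k areg) quot_space) =
     quotient_space (toprec_deg 2 1) (areg.span {ell * tau - tau * ell})"
  by (simp only: cohomology_def cocycles_2_1 coboundaries_2_1)

end
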